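(* Consider $k$ agents on $SO(3)$ with interaction graph having edge set $\mathcal{E}$ and fixed reference vectors $y_{ij}=y_{ji}\in S^2$, $(i,j)\in\mathcal{E}$, evolving according to $$\tfrac{d}{dt}Q_i=Q_i\sum_{\{j:(i,j)\in\mathcal{E}\}}\mathrm{skew}(Q_i^TM_{ij}Q_j),\qquad i=1,\ldots,k,\qquad M_{ij}=y_{ij}y_{ij}^T.$$ (a) If $k=3$, $\mathcal{E}=\{(1,2),(1,3),(2,3)\}$ and $\mathrm{rank}(y_{12},y_{13},y_{23})=\mathrm{rank}(y_{12},y_{13})=\mathrm{rank}(y_{12},y_{23})=\mathrm{rank}(y_{13},y_{23})=2$, then $C_o=C_s$. (b) If $k=3$, $\mathcal{E}=\{(1,2),(1,3),(2,3)\}$ and $\mathrm{rank}(y_{12},y_{13},y_{23})=3$, then $C_o\ne C_s$. However, output synchronization still implies state synchronization locally, i.e. there is a neighborhood $U$ of $C_s$ in $(SO(3))^3$ with $C_o\cap U=C_s$. (c) If $k=4$, $\mathcal{E}\supseteq\{(1,2),(1,3),(1,4),(2,3),(2,4)\}$, $\mathrm{rank}(y_a,y_b,y_c)=3$ for each triple of different edges $a,b,c\in\mathcal{E}$, and $$\frac{(y_{12}\times y_{23})^T(y_{12}\times y_{13})}{y_{23}^T(y_{12}\times y_{13})}\ne\frac{(y_{12}\times y_{24})^T(y_{12}\times y_{14})}{y_{24}^T(y_{12}\times y_{14})},$$ then $C_o=C_s$.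
   Context: The interaction graph is undirected, without self-loops, with vertex set $\{1,\ldots,k\}$. $S^2$ is the unit sphere of $\mathbb{R}^3$; $\mathrm{skew}(X)=\tfrac12(X-X^T)$; $\times$ is the vector product in $\mathbb{R}^3$; $\mathrm{rank}(x_1,\ldots,x_m)$ is the rank of the matrix with columns $x_1,\ldots,x_m$; $y_a$ for an edge $a=(i,j)$ means $y_{ij}$. $C_s=\{(Q_1,\ldots,Q_k)\in(SO(3))^k: Q_1=\cdots=Q_k\}$ and $C_o=\{(Q_1,\ldots,Q_k)\in(SO(3))^k: Q_i^Ty_{ij}=Q_j^Ty_{ij}\ \forall(i,j)\in\mathcal{E}\}$. *)

theory Defs
  imports "HOL-Analysis.Analysis"
begin

unbundle cross3_syntax

text \<open>
  The vertices are \<open>{1..k}\<close>. An undirected edge is a two-element set \<open>{i, j}\<close>, and \<open>\<E>\<close> is the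
  set of edges, so that \<open>{1, 2}\<close> and \<open>{2, 1}\<close> count as one edge. The reference vectors are given by
  \<open>y :: nat \<Rightarrow> nat \<Rightarrow> real^3\<close>; its values off the edges are irrelevant.
\<close>

definition interaction_graph :: "nat \<Rightarrow> nat set set \<Rightarrow> bool" where
  "interaction_graph k \<E> \<longleftrightarrow> \<E> \<subseteq> {{i, j} | i j. i \<in> {1..k} \<and> j \<in> {1..k} \<and> i \<noteq> j}"

definition reference_vectors :: "nat set set \<Rightarrow> (nat \<Rightarrow> nat \<Rightarrow> real^3) \<Rightarrow> bool" where
  "reference_vectors \<E> y \<longleftrightarrow>
     (\<forall>i j. {i, j} \<in> \<E> \<longrightarrow> y i j = y j i \<and> y i j \<in> sphere 0 1)"

definition SO3 :: "(real^3^3) set" where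
  "SO3 = {Q. rotation_matrix Q}"

text \<open>
  Elements of \<open>SO(3)\<^sup>k\<close> are the functions on \<open>{1..k}\<close> that are \<open>undefined\<close> elsewhere, which is the
  carrier of the product topology below.
\<close>

definition SO3_power :: "nat \<Rightarrow> (nat \<Rightarrow> real^3^3) set" where
  "SO3_power k = PiE {1..k} (\<lambda>_. SO3)"

definition SO3_power_topology :: "nat \<Rightarrow> (nat \<Rightarrow> real^3^3) topology" where
  "SO3_power_topology k = product_topology (\<lambda>_. top_of_set SO3) {1..k}"

lemma topspace_SO3_power_topology: "topspace (SO3_power_topology k) = SO3_power k"
  by (simp add: SO3_power_topology_def SO3_power_def)

definition skew :: "real^3^3 \<Rightarrow> real^3^3" where
  "skew X = (1 / 2) *\<^sub>R (X - transpose X)"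

definition coupling :: "(nat \<Rightarrow> nat \<Rightarrow> real^3) \<Rightarrow> nat \<Rightarrow> nat \<Rightarrow> real^3^3" where
  "coupling y i j = columnvector (y i j) ** (rowvector (y i j) :: real^3^1)"

lemma coupling_nth: "coupling y i j $ a $ b = y i j $ a * y i j $ b"
  by (simp add: coupling_def matrix_matrix_mult_def columnvector_def rowvector_def)

text \<open>Solutions on the time interval \<open>[0, \<infinity>)\<close>; the derivative at time 0 is one-sided.\<close>

definition evolves ::
    "nat \<Rightarrow> nat set set \<Rightarrow> (nat \<Rightarrow> nat \<Rightarrow> real^3) \<Rightarrow> (real \<Rightarrow> nat \<Rightarrow> real^3^3) \<Rightarrow> bool" where
  "evolves k \<E> y Q \<longleftrightarrow>
     (\<forall>t\<ge>0. Q t \<in> SO3_power k \<and>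
       (\<forall>i\<in>{1..k}.
         ((\<lambda>s. Q s i) has_vector_derivative
            Q t i ** (\<Sum>j | {i, j} \<in> \<E>. skew (transpose (Q t i) ** coupling y i j ** Q t j)))
          (at t within {0..})))"

text \<open>Solutions always exist: a constant synchronized configuration is an equilibrium.\<close>

lemma evolves_const: "evolves k \<E> y (\<lambda>t. restrict (\<lambda>i. mat 1) {1..k})"
  if "interaction_graph k \<E>"
proof -
  have sym: "transpose (coupling y i j) = coupling y i j" for i j
    by (simp add: vec_eq_iff transpose_def coupling_nth mult.commute)
  have vert: "j \<in> {1..k}" if e: "{i, j} \<in> \<E>" for i j
  proof -
    from e \<open>interaction_graph k \<E>\<close> obtain a b where "{i, j} = {a, b}" "a \<in> {1..k}" "b \<in> {1..k}"
      unfolding interaction_graph_def by blast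
    then show ?thesis by (metis insertCI insertE singletonD)
  qed
  let ?Q = "restrict (\<lambda>i. mat 1 :: real^3^3) {1..k}"
  have "(\<Sum>j | {i, j} \<in> \<E>. skew (transpose (?Q i) ** coupling y i j ** ?Q j)) = 0"
    if "i \<in> {1..k}" for i
  proof (rule sum.neutral, safe)
    fix j assume "{i, j} \<in> \<E>"
    then have "?Q j = mat 1" using vert by simp
    moreover have "?Q i = mat 1" using that by simp
    ultimately show "skew (transpose (?Q i) ** coupling y i j ** ?Q j) = 0"
      by (simp add: skew_def sym)
  qed
  moreover have "?Q \<in> SO3_power k"
    by (auto simp: SO3_power_def SO3_def rotation_matrix_def orthogonal_matrix_id)
  ultimately show ?thesis
    unfolding evolves_def by simp
qed

definition C_s :: "nat \<Rightarrow> (nat \<Rightarrow> real^3^3) set" where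
  "C_s k = {Q \<in> SO3_power k. \<forall>i\<in>{1..k}. \<forall>j\<in>{1..k}. Q i = Q j}"

definition C_o :: "nat \<Rightarrow> nat set set \<Rightarrow> (nat \<Rightarrow> nat \<Rightarrow> real^3) \<Rightarrow> (nat \<Rightarrow> real^3^3) set" where
  "C_o k \<E> y = {Q \<in> SO3_power k.
     \<forall>i j. {i, j} \<in> \<E> \<longrightarrow> transpose (Q i) *v y i j = transpose (Q j) *v y i j}"

text \<open>\<open>vector\<close> lists the rows of a matrix, hence the transposes.\<close>

definition rank2 :: "real^3 \<Rightarrow> real^3 \<Rightarrow> nat" where
  "rank2 u v = rank (transpose (vector [u, v]) :: real^2^3)"

definition rank3 :: "real^3 \<Rightarrow> real^3 \<Rightarrow> real^3 \<Rightarrow> nat" where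
  "rank3 u v w = rank (transpose (vector [u, v, w]) :: real^3^3)"

end

theory Submission
  imports Defs
begin

text \<open>
  On a triangle of edges with reference vectors \<open>a = y\<^sub>1\<^sub>2\<close>, \<open>b = y\<^sub>2\<^sub>3\<close>, \<open>c = y\<^sub>1\<^sub>3\<close>, output
  synchronization makes \<open>Q\<^sub>1 Q\<^sub>2\<^sup>T b\<close> have the same length and the same inner products with \<open>a\<close> and
  \<open>c\<close> as \<open>b\<close>. So it is either \<open>b\<close>, which forces \<open>Q\<^sub>1 = Q\<^sub>2 = Q\<^sub>3\<close>, or the mirror image of \<open>b\<close> in
  the plane spanned by \<open>a\<close> and \<open>c\<close>. For coplanar vectors the two coincide; for independent ones the
  mirror image is a fixed vector different from \<open>b\<close>, so the second case stays away from \<open>C\<^sub>s\<close>.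
  In the second case the rotation \<open>Q\<^sub>1 Q\<^sub>2\<^sup>T\<close> about \<open>a\<close> has a half-angle whose cotangent is, up to
  sign, \<open>(a \<times> b) \<bullet> (a \<times> c) / (b \<bullet> (a \<times> c))\<close>. Two triangles sharing the edge \<open>{1, 2}\<close> with different
  values of this ratio therefore cannot both be in the second case.
\<close>

section \<open>Vector identities and rotations of three-space\<close>

declare transpose_matrix_vector [simp del]

text \<open>Cramer's rule for the coordinates of \<open>x\<close> with respect to \<open>u\<close>,
  \<open>v\<close>, \<open>w\<close>, multiplied by the determinant so that no independence is
  required.\<close>

lemma cross3_cramer:
  "(u \<bullet> (v \<times> w)) *\<^sub>R x = (x \<bullet> (v \<times> w)) *\<^sub>R u + (x \<bullet> (w \<times> u)) *\<^sub>R v + (x \<bullet> (u \<times> v)) *\<^sub>R w"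
  by (simp add: forall_3 cross3_simps)

lemma triple_product_nonzero:
  assumes "u \<bullet> (v \<times> w) \<noteq> 0"
  shows "u \<times> v \<noteq> 0" "v \<times> w \<noteq> 0" "u \<times> w \<noteq> 0"
proof -
  have "u \<bullet> (v \<times> w) = w \<bullet> (u \<times> v)" "u \<bullet> (v \<times> w) = - (v \<bullet> (u \<times> w))"
    by (simp_all add: cross3_simps)
  with assms show "u \<times> v \<noteq> 0" "v \<times> w \<noteq> 0" "u \<times> w \<noteq> 0"
    by auto
qed

text \<open>The vectors \<open>u\<close>, \<open>v\<close>, \<open>u \<times> v\<close> form a
  basis, since their determinant is the squared length of \<open>u \<times> v\<close>.\<close>

lemma linear_eq_0_cross:
  fixes f :: "real^3 \<Rightarrow> 'a::real_vector"
  assumes "linear f" "f u = 0" "f v = 0" "f (u \<times> v) = 0" "u \<times> v \<noteq> 0"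
  shows "f x = 0"
proof -
  let ?n = "u \<times> v"
  have "(?n \<bullet> ?n) *\<^sub>R f x = f ((?n \<bullet> ?n) *\<^sub>R x)"
    using assms(1) by (simp add: linear_scale)
  also have "\<dots> = 0"
    unfolding cross3_cramer[of ?n u v x]
    using assms by (simp add: linear_add linear_scale)
  finally show ?thesis
    using assms(5) by simp
qed

lemma rotation_matrix_transpose:
  fixes P :: "real^'n^'n"
  assumes "rotation_matrix P"
  shows "rotation_matrix (transpose P)"
  using assms by (simp add: rotation_matrix_def orthogonal_matrix_transpose det_transpose)

lemma orthogonal_matrix_inner:
  fixes P :: "real^'n^'n"
  assumes "orthogonal_matrix P"
  shows "(P *v x) \<bullet> (P *v z) = x \<bullet> z"
  using assms orthogonal_transformation_matrix[of "(*v) P"]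
  by (simp add: orthogonal_transformation_def)

lemma rotation_matrix_mult_transpose:
  assumes "rotation_matrix P"
  shows "P *v (transpose P *v x) = x"
  using assms by (simp add: matrix_vector_mul_assoc rotation_matrix_def orthogonal_matrix_def)

text \<open>Rotations preserve cross products, so agreement on \<open>u\<close> and \<open>v\<close>
  extends to \<open>u \<times> v\<close> and hence to a basis.\<close>

lemma rotation_matrix_eqI:
  fixes P Q :: "real^3^3"
  assumes "rotation_matrix P" "rotation_matrix Q" "P *v u = Q *v u" "P *v v = Q *v v" "u \<times> v \<noteq> 0"
  shows "P = Q"
proof -
  have "linear (\<lambda>x. P *v x - Q *v x)"
    by (intro linear_compose_sub matrix_vector_mul_linear)
  moreover have "P *v (u \<times> v) = Q *v (u \<times> v)"
    using assms by (simp flip: cross_rotation_matrix)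
  ultimately have "P *v x - Q *v x = 0" for x
    using assms linear_eq_0_cross[of "\<lambda>x. P *v x - Q *v x" u v x] by simp
  then show ?thesis
    by (simp add: matrix_eq)
qed

section \<open>Mirror images and the half-angle relation\<close>

text \<open>Reflection in the plane orthogonal to \<open>n\<close>, where \<open>n\<close> need not
  have unit length.\<close>

definition mirror :: "real^3 \<Rightarrow> real^3 \<Rightarrow> real^3" where
  "mirror n b = b - (2 * (b \<bullet> n) / (n \<bullet> n)) *\<^sub>R n"

lemma mirror_orthogonal: "b \<bullet> n = 0 \<Longrightarrow> mirror n b = b"
  by (simp add: mirror_def)

lemma mirror_eq_iff: "n \<noteq> 0 \<Longrightarrow> mirror n b = b \<longleftrightarrow> b \<bullet> n = 0"
  by (simp add: mirror_def)

text \<open>The inner products with \<open>a\<close> and \<open>c\<close> determine \<open>w\<close>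
  up to a multiple \<open>s\<close> of the normal \<open>a \<times> c\<close>. Equality of lengths
  is then a quadratic equation in \<open>s\<close>, whose roots give \<open>b\<close> and its mirror
  image.\<close>

lemma same_inner_cases:
  fixes a b c w :: "real^3"
  assumes "a \<times> c \<noteq> 0" "w \<bullet> a = b \<bullet> a" "w \<bullet> c = b \<bullet> c" "w \<bullet> w = b \<bullet> b"
  shows "w = b \<or> w = mirror (a \<times> c) b"
proof -
  define n where "n = a \<times> c"
  have n: "n \<bullet> n \<noteq> 0"
    using assms by (simp add: n_def)
  define s where "s = ((w - b) \<bullet> n) / (n \<bullet> n)"
  \<comment> \<open>Both \<open>c \<times> n\<close> and \<open>n \<times> a\<close> lie in the span
    of \<open>a\<close> and \<open>c\<close>, to which \<open>w - b\<close> is orthogonal. Hence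
    only the coefficient of \<open>n\<close> survives in Cramer's rule.\<close>
  have "(w - b) \<bullet> (c \<times> n) = 0" "(w - b) \<bullet> (n \<times> a) = 0"
    using assms unfolding n_def
    by (simp_all add: Lagrange cross_skew[of "a \<times> c"] inner_diff_left inner_diff_right)
  then have "(n \<bullet> n) *\<^sub>R (w - b) = ((w - b) \<bullet> n) *\<^sub>R n"
    using cross3_cramer[of n a c "w - b"] by (simp flip: n_def)
  then have "(1 / (n \<bullet> n)) *\<^sub>R ((n \<bullet> n) *\<^sub>R (w - b)) = s *\<^sub>R n"
    by (simp add: s_def)
  then have "w - b = s *\<^sub>R n"
    using n by simp
  then have w: "w = b + s *\<^sub>R n"
    by (simp add: algebra_simps)
  then have "s * (2 * (b \<bullet> n) + s * (n \<bullet> n)) = 0"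
    using assms(4) by (simp add: inner_simps inner_commute algebra_simps)
  then have "s = 0 \<or> s * (n \<bullet> n) = - (2 * (b \<bullet> n))"
    by auto
  then have "s = 0 \<or> s = - (2 * (b \<bullet> n) / (n \<bullet> n))"
    using n by (simp add: field_simps add_eq_0_iff)
  then show ?thesis
    using w unfolding mirror_def n_def by auto
qed

text \<open>Both sides are multiples of the normal \<open>a \<times> c\<close>: the sum of
  \<open>b\<close> and its mirror image lies in the plane of \<open>a\<close> and \<open>c\<close>,
  and their difference is normal to it. The factor is the ratio that is compared for the two
  triangles.\<close>

lemma mirror_cross_ratio:
  assumes "b \<bullet> (a \<times> c) \<noteq> 0"
  shows "a \<times> (b + mirror (a \<times> c) b) =
    (((a \<times> b) \<bullet> (a \<times> c)) / (b \<bullet> (a \<times> c))) *\<^sub>R (b - mirror (a \<times> c) b)"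
proof -
  define n where "n = a \<times> c"
  have n: "n \<bullet> n \<noteq> 0" "b \<bullet> n \<noteq> 0"
    using assms by (auto simp: n_def)
  \<comment> \<open>The left side is \<open>a\<close> crossed with the projection of
    \<open>b\<close> to the plane, scaled by \<open>n \<bullet> n\<close>. It is normal to the
    plane, and its inner product with \<open>n\<close> gives the coefficient.\<close>
  have "(n \<bullet> n) *\<^sub>R (a \<times> b) - (b \<bullet> n) *\<^sub>R (a \<times> n) = ((a \<times> b) \<bullet> n) *\<^sub>R n"
    unfolding n_def by (simp add: forall_3 cross3_simps)
  then have "(2 / (n \<bullet> n)) *\<^sub>R ((n \<bullet> n) *\<^sub>R (a \<times> b) - (b \<bullet> n) *\<^sub>R (a \<times> n))
      = (2 / (n \<bullet> n)) *\<^sub>R (((a \<times> b) \<bullet> n) *\<^sub>R n)"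
    by simp
  then have "a \<times> b + a \<times> b - (2 * (b \<bullet> n) / (n \<bullet> n)) *\<^sub>R (a \<times> n)
      = (2 * ((a \<times> b) \<bullet> n) / (n \<bullet> n)) *\<^sub>R n"
    using n by (simp add: scaleR_diff_right flip: scaleR_2)
  moreover have "(((a \<times> b) \<bullet> n) / (b \<bullet> n)) *\<^sub>R (b - mirror n b) =
      (2 * ((a \<times> b) \<bullet> n) / (n \<bullet> n)) *\<^sub>R n"
    using n by (simp add: mirror_def)
  ultimately have "a \<times> (b + mirror n b) = (((a \<times> b) \<bullet> n) / (b \<bullet> n)) *\<^sub>R (b - mirror n b)"
    unfolding mirror_def cross_add_right Cross3.right_diff_distrib cross_mult_right
    by (simp only: add_diff_eq)
  then show ?thesis
    by (simp add: n_def)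
qed

text \<open>For a rotation by the angle \<open>\<theta>\<close> about the unit vector \<open>a\<close>, the factor \<open>r\<close> is \<open>-cot (\<theta>/2)\<close>.\<close>

lemma half_angle_relation:
  fixes R :: "real^3^3"
  assumes R: "rotation_matrix R" and Ra: "R *v a = a" and "a \<times> b \<noteq> 0"
    and b: "a \<times> (b + R *v b) = r *\<^sub>R (b - R *v b)"
  shows "a \<times> (x + R *v x) = r *\<^sub>R (x - R *v x)"
proof -
  let ?f = "\<lambda>x. a \<times> (x + R *v x) - r *\<^sub>R (x - R *v x)"
  \<comment> \<open>As \<open>R\<close> fixes \<open>a\<close>, it commutes with the map
    \<open>x \<mapsto> a \<times> x\<close>. The relation therefore passes from \<open>b\<close> to
    \<open>a \<times> b\<close>; it is trivial at \<open>a\<close>, and linearity covers the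
    rest.\<close>
  have R_cross: "R *v (a \<times> x) = a \<times> (R *v x)" for x
    using cross_rotation_matrix[OF R, of a x] Ra by simp
  have "linear ?f"
    by (rule linearI)
      (simp_all add: matrix_vector_right_distrib matrix_vector_mult_scaleR cross_add_right
        cross_mult_right algebra_simps)
  moreover have "?f a = 0"
    unfolding Ra cross_add_right by simp
  moreover have "?f b = 0"
    using b by simp
  moreover have "?f (a \<times> b) = a \<times> ?f b"
    by (simp add: R_cross cross_add_right Cross3.right_diff_distrib cross_mult_right)
  ultimately have "?f x = 0"
    using linear_eq_0_cross[of ?f a b x] assms(3) by simp
  then show ?thesis
    by simp
qed

text \<open>The vector \<open>w = P *v (transpose Q *v b)\<close> is the one that
  \<open>transpose P\<close> sends to the common output of \<open>b\<close> at \<open>Q\<close> and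
  \<open>R\<close>. Comparing outputs at \<open>P\<close> and \<open>Q\<close> gives its inner
  product with \<open>a\<close>, at \<open>P\<close> and \<open>R\<close> the one with
  \<open>c\<close>.\<close>

lemma triangle_cases:
  fixes P Q R :: "real^3^3"
  assumes rot: "rotation_matrix P" "rotation_matrix Q" "rotation_matrix R"
    and a: "transpose P *v a = transpose Q *v a"
    and b: "transpose Q *v b = transpose R *v b"
    and c: "transpose P *v c = transpose R *v c"
    and indep: "a \<times> b \<noteq> 0" "b \<times> c \<noteq> 0" "a \<times> c \<noteq> 0"
  shows "P = Q \<and> Q = R \<or>
    P *v (transpose Q *v b) = mirror (a \<times> c) b \<and> mirror (a \<times> c) b \<noteq> b"
proof -
  note rot' = rot[THEN rotation_matrix_transpose]
  note inner = rot'[unfolded rotation_matrix_def, THEN conjunct1, THEN orthogonal_matrix_inner]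
  define w where "w = P *v (transpose Q *v b)"
  have w: "transpose P *v w = transpose Q *v b"
    using rotation_matrix_mult_transpose[OF rot'(1)] by (simp add: w_def)
  have "w \<bullet> a = b \<bullet> a" "w \<bullet> c = b \<bullet> c" "w \<bullet> w = b \<bullet> b"
    using inner w a b c by metis+
  then consider "w = b" | "w = mirror (a \<times> c) b" "w \<noteq> b"
    using same_inner_cases indep by blast
  then show ?thesis
  proof cases
    case 1
    \<comment> \<open>Now \<open>transpose P\<close> agrees with \<open>transpose Q\<close> on
      \<open>a\<close> and \<open>b\<close>, and with \<open>transpose R\<close> on \<open>b\<close>
      and \<open>c\<close>.\<close>
    then have "transpose P = transpose Q" "transpose R = transpose P"
      using w a b c rot' indep rotation_matrix_eqI by metis+
    then show ?thesis
      by (metis transpose_transpose)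
  qed (auto simp: w_def)
qed

section \<open>Half-turns\<close>

text \<open>Rotation by the angle pi about the axis \<open>n\<close>, that is, the negative of the
  reflection in the plane orthogonal to \<open>n\<close>.\<close>

definition half_turn :: "real^3 \<Rightarrow> real^3^3" where
  "half_turn n = (\<chi> i j. 2 / (n \<bullet> n) * (n $ i * n $ j) - mat 1 $ i $ j)"

lemma half_turn_mult: "half_turn n *v x = - mirror n x"
proof -
  define s where "s = 2 / (n \<bullet> n)"
  have "2 * (x \<bullet> n) / (n \<bullet> n) = s * (x \<bullet> n)"
    by (simp add: s_def)
  then show ?thesis
    by (simp add: half_turn_def mirror_def matrix_vector_mult_def vec_eq_iff forall_3 sum_3
        inner_vec_def[of x n] mat_def algebra_simps flip: s_def)
qed

lemma transpose_half_turn: "transpose (half_turn n) = half_turn n"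
  by (simp add: half_turn_def transpose_def vec_eq_iff mat_def mult.commute)

lemma mirror_mirror: "n \<noteq> 0 \<Longrightarrow> mirror n (- mirror n x) = - x"
  by (simp add: mirror_def inner_diff_left algebra_simps)

lemma det_half_turn:
  assumes "n \<noteq> 0"
  shows "det (half_turn n) = 1"
proof -
  define s where "s = 2 / (n \<bullet> n)"
  have "s * (n \<bullet> n) = 2"
    using assms by (simp add: s_def)
  then have s: "s * (n $ 1 * n $ 1 + n $ 2 * n $ 2 + n $ 3 * n $ 3) = 2"
    by (simp add: inner_vec_def sum_3)
  \<comment> \<open>The terms of degree two and three in \<open>s\<close> cancel because the matrix
    of the products \<open>n $ i * n $ j\<close> has rank at most one.\<close>
  have "det (half_turn n) = s * (n $ 1 * n $ 1 + n $ 2 * n $ 2 + n $ 3 * n $ 3) - 1"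
    by (simp add: half_turn_def det_3 mat_def algebra_simps flip: s_def)
  then show ?thesis
    using s by simp
qed

lemma rotation_matrix_half_turn:
  assumes "n \<noteq> 0"
  shows "rotation_matrix (half_turn n)"
  using assms
  by (simp add: rotation_matrix_def orthogonal_matrix transpose_half_turn matrix_eq det_half_turn
      half_turn_mult mirror_mirror flip: matrix_vector_mul_assoc)

section \<open>Rank conditions as cross and triple products\<close>

lemma rank3_eq_3_iff: "rank3 u v w = 3 \<longleftrightarrow> u \<bullet> (v \<times> w) \<noteq> 0"
proof -
  have "rank3 u v w \<le> 3"
    using rank_bound[of "transpose (vector [u, v, w]) :: real^3^3"] by (simp add: rank3_def)
  moreover have "u \<bullet> (v \<times> w) = 0 \<longleftrightarrow> rank3 u v w < 3"
    using det_eq_0_rank[of "transpose (vector [u, v, w]) :: real^3^3"]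
    by (simp add: dot_cross_det rank3_def det_transpose)
  ultimately show ?thesis
    by auto
qed

text \<open>A vanishing cross product puts both columns on a line, which leaves a column space of
  dimension at most one.\<close>

lemma rank2_eq_2_cross:
  assumes "rank2 u v = 2"
  shows "u \<times> v \<noteq> 0"
proof
  assume "u \<times> v = 0"
  then obtain x where x: "{0, u, v} \<subseteq> span {x}"
    unfolding cross_eq_0 collinear_lemma
    by (metis empty_subsetI insert_subset insertCI span_0 span_base span_scale)
  have "rows (vector [u, v] :: real^3^2) = range (($) (vector [u, v] :: real^3^2))"
    by (auto simp: rows_def row_def vec_lambda_eta)
  then have "rows (vector [u, v] :: real^3^2) = {u, v}"
    by (simp add: UNIV_2)
  then have "rank2 u v = dim {u, v}"
    by (simp only: rank2_def column_rank_def columns_transpose)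
  also have "\<dots> \<le> dim (span {x})"
    using x by (intro dim_subset) auto
  also have "\<dots> \<le> 1"
    by (simp add: dim_insert)
  finally show False
    using assms by simp
qed

section \<open>Output and state synchronization\<close>

lemma C_s_subset_C_o:
  assumes "interaction_graph k \<E>"
  shows "C_s k \<subseteq> C_o k \<E> y"
proof
  fix Q assume Q: "Q \<in> C_s k"
  have "Q i = Q j" if edge: "{i, j} \<in> \<E>" for i j
  proof -
    obtain a b where ab: "{i, j} = {a, b}" "a \<in> {1..k}" "b \<in> {1..k}"
      using edge assms unfolding interaction_graph_def by blast
    then have "{i, j} \<subseteq> {1..k}"
      unfolding ab(1) by simp
    then show ?thesis
      using Q by (simp add: C_s_def)
  qed
  then have "\<forall>i j. {i, j} \<in> \<E> \<longrightarrow> transpose (Q i) *v y i j = transpose (Q j) *v y i j"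
    by metis
  then show "Q \<in> C_o k \<E> y"
    using Q by (simp add: C_s_def C_o_def)
qed

lemma SO3_power_rotation: "Q \<in> SO3_power k \<Longrightarrow> i \<in> {1..k} \<Longrightarrow> rotation_matrix (Q i)"
  by (auto simp: SO3_power_def SO3_def)

lemma C_o_edge: "Q \<in> C_o k \<E> y \<Longrightarrow> {i, j} \<in> \<E> \<Longrightarrow> transpose (Q i) *v y i j = transpose (Q j) *v y i j"
  unfolding C_o_def by blast

lemma C_o_triangle_cases:
  assumes Q: "Q \<in> C_o k \<E> y" and "i \<in> {1..k}" "j \<in> {1..k}" "l \<in> {1..k}"
    and "{{i, j}, {i, l}, {j, l}} \<subseteq> \<E>"
    and "y i j \<times> y j l \<noteq> 0" "y j l \<times> y i l \<noteq> 0" "y i j \<times> y i l \<noteq> 0"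
  shows "Q i = Q j \<and> Q j = Q l \<or>
    Q i *v (transpose (Q j) *v y j l) = mirror (y i j \<times> y i l) (y j l) \<and>
    mirror (y i j \<times> y i l) (y j l) \<noteq> y j l"
proof -
  have "Q \<in> SO3_power k"
    using Q by (simp add: C_o_def)
  then show ?thesis
    using assms C_o_edge[OF Q] SO3_power_rotation by (intro triangle_cases) auto
qed

text \<open>Serves to cut out the mirror case by an open condition.\<close>

lemma continuous_map_SO3_power_orbit:
  assumes "i \<in> {1..k}" "j \<in> {1..k}"
  shows "continuous_map (SO3_power_topology k) euclidean (\<lambda>Q. Q i *v (transpose (Q j) *v v))"
proof -
  have proj: "continuous_map (SO3_power_topology k) euclidean (\<lambda>Q. Q l)" if "l \<in> {1..k}" for l
    unfolding SO3_power_topology_def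
    by (rule continuous_map_into_fulltopology, rule continuous_map_product_projection) (rule that)
  have "continuous_map (SO3_power_topology k) (prod_topology euclidean euclidean)
      (\<lambda>Q. (Q i, Q j))"
    using assms by (intro continuous_map_pairedI proj)
  moreover have "continuous_map (prod_topology euclidean euclidean) euclidean
      (\<lambda>(M :: real^3^3, N). M *v (transpose N *v v))"
    unfolding matrix_vector_mult_def transpose_def split_def prod_topology_euclidean
      continuous_map_iff_continuous2
    by (intro continuous_on_vec_lambda continuous_on_sum continuous_on_mult continuous_on_component
        continuous_on_fst continuous_on_snd continuous_on_id continuous_on_const)
  ultimately have "continuous_map (SO3_power_topology k) euclidean
      ((\<lambda>(M, N). M *v (transpose N *v v)) \<circ> (\<lambda>Q. (Q i, Q j)))"
    by (rule continuous_map_compose)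
  then show ?thesis
    unfolding o_def split_conv .
qed

lemma C_o_neq_C_s:
  fixes y :: "nat \<Rightarrow> nat \<Rightarrow> real^3"
  assumes \<E>: "\<E> = {{1, 2}, {1, 3}, {2, 3}}" and y: "reference_vectors \<E> y"
    and D: "y 1 2 \<bullet> (y 1 3 \<times> y 2 3) \<noteq> 0"
  shows "C_o 3 \<E> y \<noteq> C_s 3"
proof -
  \<comment> \<open>\<open>Q i\<close> is a half-turn about the normal of the two reference vectors at vertex \<open>i\<close>,
    so it reverses both of them.\<close>
  define Q where "Q = restrict (\<lambda>i::nat. half_turn
    (if i = 1 then y 1 2 \<times> y 1 3 else if i = 2 then y 1 2 \<times> y 2 3 else y 1 3 \<times> y 2 3)) {1..3}"
  have Q: "Q 1 = half_turn (y 1 2 \<times> y 1 3)" "Q 2 = half_turn (y 1 2 \<times> y 2 3)"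
    "Q 3 = half_turn (y 1 3 \<times> y 2 3)"
    by (simp_all add: Q_def)
  have D': "y 2 3 \<bullet> (y 1 2 \<times> y 1 3) \<noteq> 0"
    using D by (simp add: cross3_simps)
  have nz: "y 1 2 \<times> y 1 3 \<noteq> 0" "y 1 2 \<times> y 2 3 \<noteq> 0" "y 1 3 \<times> y 2 3 \<noteq> 0"
    using triple_product_nonzero[OF D] by simp_all
  have sym: "y 2 1 = y 1 2" "y 3 1 = y 1 3" "y 3 2 = y 2 3"
    using y \<E> unfolding reference_vectors_def by (metis insertCI insert_commute)+
  have Q_in: "Q \<in> SO3_power 3"
    unfolding SO3_power_def SO3_def Q_def
    using nz rotation_matrix_half_turn by (intro restrict_PiE_iff[THEN iffD2]) auto
  have "transpose (Q i) *v y i j = transpose (Q j) *v y i j" if "{i, j} \<in> \<E>" for i j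
    using that unfolding \<E>
    by (auto simp: doubleton_eq_iff Q sym transpose_half_turn half_turn_mult mirror_orthogonal
        dot_cross_self simp del: One_nat_def)
  then have "Q \<in> C_o 3 \<E> y"
    using Q_in unfolding C_o_def by blast
  moreover have "Q \<notin> C_s 3"
  proof
    assume "Q \<in> C_s 3"
    then have "Q 1 = Q 2"
      by (auto simp: C_s_def)
    \<comment> \<open>\<open>Q 2\<close> reverses \<open>y 2 3\<close>, whereas \<open>Q 1\<close>
      would do so only if \<open>y 2 3\<close> lay in the plane of \<open>y 1 2\<close> and
      \<open>y 1 3\<close>.\<close>
    then have "Q 1 *v y 2 3 = Q 2 *v y 2 3"
      by simp
    then have "mirror (y 1 2 \<times> y 1 3) (y 2 3) = y 2 3"
      by (simp add: Q half_turn_mult mirror_orthogonal dot_cross_self del: One_nat_def)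
    then show False
      using D' nz by (simp add: mirror_eq_iff)
  qed
  ultimately show ?thesis
    by blast
qed

lemma C_o_eq_C_s_locally:
  fixes y :: "nat \<Rightarrow> nat \<Rightarrow> real^3"
  assumes graph: "interaction_graph 3 \<E>" and \<E>: "\<E> = {{1, 2}, {1, 3}, {2, 3}}"
    and D: "y 1 2 \<bullet> (y 1 3 \<times> y 2 3) \<noteq> 0"
  shows "\<exists>U. openin (SO3_power_topology 3) U \<and> C_s 3 \<subseteq> U \<and> C_o 3 \<E> y \<inter> U = C_s 3"
proof -
  let ?w = "mirror (y 1 2 \<times> y 1 3) (y 2 3)"
  let ?f = "\<lambda>Q :: nat \<Rightarrow> real^3^3. Q 1 *v (transpose (Q 2) *v y 2 3)"
  \<comment> \<open>The excluded value is the one forced by the unsynchronized case of the triangle.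
    On \<open>C_s 3\<close> the value is \<open>y 2 3\<close>, which differs from it by
    independence.\<close>
  define U where "U = {Q \<in> topspace (SO3_power_topology 3). ?f Q \<in> - {?w}}"
  have D': "y 2 3 \<bullet> (y 1 2 \<times> y 1 3) \<noteq> 0"
    using D by (simp add: cross3_simps)
  have nz: "y 1 2 \<times> y 1 3 \<noteq> 0" "y 1 2 \<times> y 2 3 \<noteq> 0" "y 2 3 \<times> y 1 3 \<noteq> 0"
    using triple_product_nonzero[OF D] triple_product_nonzero[OF D'] by simp_all
  have "openin (SO3_power_topology 3) U"
    unfolding U_def
    by (intro openin_continuous_map_preimage[where Y = euclidean] continuous_map_SO3_power_orbit) auto
  moreover have "C_s 3 \<subseteq> U"
  proof
    fix Q assume Q: "Q \<in> C_s 3"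
    then have Q': "Q \<in> SO3_power 3" "Q 1 = Q 2"
      by (auto simp: C_s_def)
    then have "?f Q = y 2 3"
      using SO3_power_rotation[of Q 3 2] by (simp add: rotation_matrix_mult_transpose)
    moreover have "?w \<noteq> y 2 3"
      using nz D' by (simp add: mirror_eq_iff)
    ultimately show "Q \<in> U"
      using Q' by (simp add: U_def topspace_SO3_power_topology)
  qed
  moreover have "C_o 3 \<E> y \<inter> U \<subseteq> C_s 3"
  proof
    fix Q assume Q: "Q \<in> C_o 3 \<E> y \<inter> U"
    then have "Q 1 = Q 2 \<and> Q 2 = Q 3"
      using C_o_triangle_cases[of Q 3 \<E> y 1 2 3] nz \<E> by (auto simp: U_def)
    moreover have "{1..3} = {1, 2, 3 :: nat}"
      by auto
    ultimately show "Q \<in> C_s 3"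
      using Q by (auto simp: C_s_def C_o_def)
  qed
  ultimately show ?thesis
    using C_s_subset_C_o[OF graph] by blast
qed

text \<open>Since \<open>y 2 3\<close> lies in the plane of the other two vectors, it is its own
  mirror image, which rules out the unsynchronized case.\<close>

lemma C_o_eq_C_s_coplanar:
  fixes y :: "nat \<Rightarrow> nat \<Rightarrow> real^3"
  assumes graph: "interaction_graph 3 \<E>" and \<E>: "\<E> = {{1, 2}, {1, 3}, {2, 3}}"
    and D: "y 1 2 \<bullet> (y 1 3 \<times> y 2 3) = 0"
    and nz: "y 1 2 \<times> y 1 3 \<noteq> 0" "y 1 2 \<times> y 2 3 \<noteq> 0" "y 1 3 \<times> y 2 3 \<noteq> 0"
  shows "C_o 3 \<E> y = C_s 3"
proof
  show "C_o 3 \<E> y \<subseteq> C_s 3"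
  proof
    fix Q assume Q: "Q \<in> C_o 3 \<E> y"
    have "y 2 3 \<times> y 1 3 \<noteq> 0"
      using nz(3) cross_skew[of "y 1 3" "y 2 3"] by auto
    moreover have "y 2 3 \<bullet> (y 1 2 \<times> y 1 3) = 0"
      using D by (simp add: cross3_simps)
    ultimately have "Q 1 = Q 2 \<and> Q 2 = Q 3"
      using C_o_triangle_cases[OF Q, of 1 2 3] nz \<E> by (simp add: mirror_orthogonal)
    moreover have "{1..3} = {1, 2, 3 :: nat}"
      by auto
    ultimately show "Q \<in> C_s 3"
      using Q by (auto simp: C_s_def C_o_def)
  qed
qed (rule C_s_subset_C_o[OF graph])

text \<open>The rotation \<open>R = Q 1 ** transpose (Q 2)\<close> belongs to both triangles and
  fixes \<open>y 1 2\<close>. If \<open>Q 1\<close> and \<open>Q 2\<close> differed, each triangle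
  would impose the half-angle relation on \<open>R\<close> with its own ratio as the factor.\<close>

lemma C_o_eq_C_s_two_triangles:
  assumes graph: "interaction_graph 4 \<E>" and \<E>: "{{1, 2}, {1, 3}, {1, 4}, {2, 3}, {2, 4}} \<subseteq> \<E>"
    and D: "y 2 3 \<bullet> (y 1 2 \<times> y 1 3) \<noteq> 0" "y 2 4 \<bullet> (y 1 2 \<times> y 1 4) \<noteq> 0"
    and ratio: "((y 1 2 \<times> y 2 3) \<bullet> (y 1 2 \<times> y 1 3)) / (y 2 3 \<bullet> (y 1 2 \<times> y 1 3)) \<noteq>
      ((y 1 2 \<times> y 2 4) \<bullet> (y 1 2 \<times> y 1 4)) / (y 2 4 \<bullet> (y 1 2 \<times> y 1 4))"
  shows "C_o 4 \<E> y = C_s 4"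
proof
  show "C_o 4 \<E> y \<subseteq> C_s 4"
  proof
    fix Q assume Q: "Q \<in> C_o 4 \<E> y"
    have rot: "rotation_matrix (Q 1)" "rotation_matrix (Q 2)"
      using Q SO3_power_rotation by (auto simp: C_o_def)
    define R where "R = Q 1 ** transpose (Q 2)"
    have R_mult: "R *v x = Q 1 *v (transpose (Q 2) *v x)" for x
      by (simp only: R_def matrix_vector_mul_assoc)
    have R: "rotation_matrix R"
      using rot rotation_matrix_transpose[OF rot(2)]
      by (simp add: R_def rotation_matrix_def orthogonal_matrix_mul det_mul)
    have "transpose (Q 2) *v y 1 2 = transpose (Q 1) *v y 1 2"
      using C_o_edge[OF Q, of 1 2] \<E> by simp
    then have Ra: "R *v y 1 2 = y 1 2"
      using rot by (simp add: R_mult rotation_matrix_mult_transpose)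
    have R_id: "R *v x = x" if "Q 1 = Q 2" for x
      using that rot by (simp add: R_mult rotation_matrix_mult_transpose)
    have cases: "Q 1 = Q 2 \<and> Q 2 = Q l \<or>
        R *v y 2 l = mirror (y 1 2 \<times> y 1 l) (y 2 l) \<and> R *v y 2 l \<noteq> y 2 l"
      and indep: "y 1 2 \<times> y 2 l \<noteq> 0"
      and nz: "y 2 l \<bullet> (y 1 2 \<times> y 1 l) \<noteq> 0" if "l = 3 \<or> l = 4" for l
    proof -
      show nz: "y 2 l \<bullet> (y 1 2 \<times> y 1 l) \<noteq> 0"
        using that D by auto
      note indeps = triple_product_nonzero[OF nz]
      show indep: "y 1 2 \<times> y 2 l \<noteq> 0"
        using indeps(1) cross_skew[of "y 2 l" "y 1 2"] by auto
      have "y 2 l \<times> y 1 l \<noteq> 0" "y 1 2 \<times> y 1 l \<noteq> 0"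
        using indeps by simp_all
      then show "Q 1 = Q 2 \<and> Q 2 = Q l \<or>
          R *v y 2 l = mirror (y 1 2 \<times> y 1 l) (y 2 l) \<and> R *v y 2 l \<noteq> y 2 l"
        using C_o_triangle_cases[OF Q, of 1 2 l] that \<E> indep by (auto simp: R_mult)
    qed
    have "Q 1 = Q 2"
    proof (rule ccontr)
      assume "Q 1 \<noteq> Q 2"
      then have Rb: "R *v y 2 l = mirror (y 1 2 \<times> y 1 l) (y 2 l)" "R *v y 2 l \<noteq> y 2 l"
        if "l = 3 \<or> l = 4" for l
        using cases[OF that] by auto
      let ?r = "\<lambda>l. ((y 1 2 \<times> y 2 l) \<bullet> (y 1 2 \<times> y 1 l)) / (y 2 l \<bullet> (y 1 2 \<times> y 1 l))"
      have "y 1 2 \<times> (x + R *v x) = ?r l *\<^sub>R (x - R *v x)" if "l = 3 \<or> l = 4" for l x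
        using half_angle_relation[OF R Ra indep[OF that]] mirror_cross_ratio[OF nz[OF that]] Rb(1)[OF that]
        by simp
      \<comment> \<open>Both relations are evaluated at \<open>y 2 3\<close>, which \<open>R\<close>
        moves, so the two factors must coincide.\<close>
      then have "?r 3 *\<^sub>R (y 2 3 - R *v y 2 3) = ?r 4 *\<^sub>R (y 2 3 - R *v y 2 3)"
        by metis
      then show False
        using ratio Rb(2)[of 3] by simp
    qed
    then have "Q 1 = Q 2 \<and> Q 2 = Q 3 \<and> Q 2 = Q 4"
      using cases[of 3] cases[of 4] R_id by auto
    moreover have "{1..4} = {1, 2, 3, 4 :: nat}"
      by auto
    ultimately show "Q \<in> C_s 4"
      using Q by (auto simp: C_s_def C_o_def)
  qed
qed (rule C_s_subset_C_o[OF graph])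

theorem theorem4:
  fixes k :: nat and \<E> :: "nat set set" and y :: "nat \<Rightarrow> nat \<Rightarrow> real^3"
    and Q :: "real \<Rightarrow> nat \<Rightarrow> real^3^3"
  assumes "interaction_graph k \<E>"
    and "reference_vectors \<E> y"
    and "evolves k \<E> y Q"
  shows "(k = 3 \<and> \<E> = {{1, 2}, {1, 3}, {2, 3}} \<and>
           rank3 (y 1 2) (y 1 3) (y 2 3) = 2 \<and> rank2 (y 1 2) (y 1 3) = 2 \<and>
           rank2 (y 1 2) (y 2 3) = 2 \<and> rank2 (y 1 3) (y 2 3) = 2
          \<longrightarrow> C_o k \<E> y = C_s k) \<and>
         (k = 3 \<and> \<E> = {{1, 2}, {1, 3}, {2, 3}} \<and> rank3 (y 1 2) (y 1 3) (y 2 3) = 3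
          \<longrightarrow> C_o k \<E> y \<noteq> C_s k \<and>
              (\<exists>U. openin (SO3_power_topology k) U \<and> C_s k \<subseteq> U \<and> C_o k \<E> y \<inter> U = C_s k)) \<and>
         (k = 4 \<and> {{1, 2}, {1, 3}, {1, 4}, {2, 3}, {2, 4}} \<subseteq> \<E> \<and>
           (\<forall>i j l m p q. {i, j} \<in> \<E> \<and> {l, m} \<in> \<E> \<and> {p, q} \<in> \<E> \<and>
              {i, j} \<noteq> {l, m} \<and> {i, j} \<noteq> {p, q} \<and> {l, m} \<noteq> {p, q}
              \<longrightarrow> rank3 (y i j) (y l m) (y p q) = 3) \<and>
           ((y 1 2 \<times> y 2 3) \<bullet> (y 1 2 \<times> y 1 3)) / (y 2 3 \<bullet> (y 1 2 \<times> y 1 3)) \<noteq>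
           ((y 1 2 \<times> y 2 4) \<bullet> (y 1 2 \<times> y 1 4)) / (y 2 4 \<bullet> (y 1 2 \<times> y 1 4))
          \<longrightarrow> C_o k \<E> y = C_s k)"
proof (intro conjI impI; elim conjE)
  assume "k = 3" "\<E> = {{1, 2}, {1, 3}, {2, 3}}" "rank3 (y 1 2) (y 1 3) (y 2 3) = 2"
    and rank2: "rank2 (y 1 2) (y 1 3) = 2" "rank2 (y 1 2) (y 2 3) = 2" "rank2 (y 1 3) (y 2 3) = 2"
  then show "C_o k \<E> y = C_s k"
    using assms(1) rank3_eq_3_iff[of "y 1 2" "y 1 3" "y 2 3"] rank2[THEN rank2_eq_2_cross]
      C_o_eq_C_s_coplanar[of \<E> y] by simp
next
  assume "k = 3" "\<E> = {{1, 2}, {1, 3}, {2, 3}}" "rank3 (y 1 2) (y 1 3) (y 2 3) = 3"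
  then show "C_o k \<E> y \<noteq> C_s k"
    using assms(2) C_o_neq_C_s by (auto simp: rank3_eq_3_iff)
next
  assume "k = 3" "\<E> = {{1, 2}, {1, 3}, {2, 3}}" "rank3 (y 1 2) (y 1 3) (y 2 3) = 3"
  then show "\<exists>U. openin (SO3_power_topology k) U \<and> C_s k \<subseteq> U \<and> C_o k \<E> y \<inter> U = C_s k"
    using assms(1) C_o_eq_C_s_locally by (auto simp: rank3_eq_3_iff)
next
  assume k: "k = 4" and \<E>: "{{1, 2}, {1, 3}, {1, 4}, {2, 3}, {2, 4}} \<subseteq> \<E>"
    and rank: "\<forall>i j l m p q. {i, j} \<in> \<E> \<and> {l, m} \<in> \<E> \<and> {p, q} \<in> \<E> \<and>
              {i, j} \<noteq> {l, m} \<and> {i, j} \<noteq> {p, q} \<and> {l, m} \<noteq> {p, q}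
              \<longrightarrow> rank3 (y i j) (y l m) (y p q) = 3"
    and ratio: "((y 1 2 \<times> y 2 3) \<bullet> (y 1 2 \<times> y 1 3)) / (y 2 3 \<bullet> (y 1 2 \<times> y 1 3)) \<noteq>
           ((y 1 2 \<times> y 2 4) \<bullet> (y 1 2 \<times> y 1 4)) / (y 2 4 \<bullet> (y 1 2 \<times> y 1 4))"
  \<comment> \<open>The edges are ordered so that the triple products are the denominators of the
    two ratios.\<close>
  have "rank3 (y 2 3) (y 1 2) (y 1 3) = 3" "rank3 (y 2 4) (y 1 2) (y 1 4) = 3"
    using \<E> by (intro rank[rule_format]; simp add: doubleton_eq_iff)+
  then show "C_o k \<E> y = C_s k"
    using assms(1) k \<E> ratio C_o_eq_C_s_two_triangles by (simp add: rank3_eq_3_iff)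
qed

end
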